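(* Let $n\ge1$ be an integer. The pseudovariety $[\![1\le x^n]\!]$ of ordered monoids is contained in $(\mathsf{BG})_n$; that is, for every finite ordered monoid satisfying the inequality $1\le x^n$, the underlying monoid belongs to $(\mathsf{BG})_n$.
   Context: An ordered monoid is a monoid with a partial order compatible with multiplication on both sides. $[\![1\le x^n]\!]$ is the class of all finite ordered monoids $M$ such that $1\le s^n$ for all $s\in M$. A pseudovariety of (unordered) monoids is identified with the pseudovariety of ordered monoids consisting of all its members under all possible compatible orders. For $s$ in a finite monoid, $s^\omega$ is the unique idempotent power of $s$ with positive exponent, and $s^{\omega+1}=s^\omega s$. $\mathsf{BG}$ is the pseudovariety of finite monoids defined by the pseudoidentity $(x^\omega y)^\omega=(yx^\omega)^\omega$ (block groups). $(\mathsf{BG})_n$ is the class of members of $\mathsf{BG}$ satisfying $(xy^\omega z)^{\omega+1}=(xy^nz)^{\omega+1}$. *)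

theory Defs
  imports "HOL-Algebra.Group"
begin

(* Only meaningful for s in the carrier of a finite monoid, where the idempotent is unique. *)
definition omega_pow :: "('a, 'b) monoid_scheme \<Rightarrow> 'a \<Rightarrow> 'a" where
  "omega_pow M s = (THE e. (\<exists>k::nat. k > 0 \<and> e = s [^]\<^bsub>M\<^esub> k) \<and> e \<otimes>\<^bsub>M\<^esub> e = e)"

definition omega_succ_pow :: "('a, 'b) monoid_scheme \<Rightarrow> 'a \<Rightarrow> 'a" where
  "omega_succ_pow M s = omega_pow M s \<otimes>\<^bsub>M\<^esub> s"

locale finite_monoid = monoid M for M (structure) +
  assumes finite_carrier: "finite (carrier M)"

locale block_group_monoid = finite_monoid +
  assumes block_group: "\<lbrakk>x \<in> carrier M; y \<in> carrier M\<rbrakk> \<Longrightarrow>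
    omega_pow M (omega_pow M x \<otimes> y) = omega_pow M (y \<otimes> omega_pow M x)"

locale BG_n_monoid = block_group_monoid +
  fixes n :: nat
  assumes BG_n: "\<lbrakk>x \<in> carrier M; y \<in> carrier M; z \<in> carrier M\<rbrakk> \<Longrightarrow>
    omega_succ_pow M (x \<otimes> omega_pow M y \<otimes> z) = omega_succ_pow M (x \<otimes> y [^] n \<otimes> z)"

(* (a, b) \<in> r reads a \<le> b; partial_order_on includes r \<subseteq> carrier M \<times> carrier M. *)
locale finite_ordered_monoid = finite_monoid +
  fixes r :: "'a rel"
  assumes partial_order: "partial_order_on (carrier M) r"
    and mult_right_mono: "\<lbrakk>(a, b) \<in> r; c \<in> carrier M\<rbrakk> \<Longrightarrow> (a \<otimes> c, b \<otimes> c) \<in> r"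
    and mult_left_mono: "\<lbrakk>(a, b) \<in> r; c \<in> carrier M\<rbrakk> \<Longrightarrow> (c \<otimes> a, c \<otimes> b) \<in> r"

locale one_le_pow_monoid = finite_ordered_monoid +
  fixes n :: nat
  assumes one_le_pow: "s \<in> carrier M \<Longrightarrow> (\<one>, s [^] n) \<in> r"

end

theory Submission
  imports Defs
begin

text \<open>
  If \<open>1 \<le> s\<^sup>n\<close> holds throughout, then every idempotent \<open>f\<close> satisfies \<open>1 \<le> f\<close>. For an idempotent \<open>e\<close>, put
  \<open>f = (e y)\<^sup>\<omega>\<close> and \<open>g = (y e)\<^sup>\<omega>\<close>, so that \<open>f e = e g\<close>, \<open>e f = f\<close> and \<open>g e = g\<close>. Then
  \<open>f \<le> f e \<le> f e f = f\<close> and symmetrically \<open>e g = g\<close>, whence \<open>f = f e = e g = g\<close>.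

  For the second identity put \<open>u = y\<^sup>n\<close>, \<open>e = y\<^sup>\<omega>\<close>, \<open>a = x u z\<close> and \<open>b = x e z\<close>. Since \<open>1 \<le> u\<close>, the powers of
  \<open>u\<close> increase up to \<open>e\<close>, so \<open>a \<le> b\<close>. Conversely \<open>u \<le> (z x)\<^sup>n u \<le> (z x u)\<^sup>n\<close>, and hence for
  every \<open>k\<close> with \<open>e = u u\<^sup>k\<close> we get \<open>b \<le> x u (z x u)\<^bsup>nk\<^esup> z = a\<^bsup>nk+1\<^esup>\<close>. When \<open>k\<close> is an exponent that makes
  every \<open>k\<close>-th power idempotent, raising both inequalities to the power \<open>k + 1\<close> gives
  \<open>a\<^bsup>\<omega>+1\<^esup> = b\<^bsup>\<omega>+1\<^esup>\<close>.
\<close>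

section \<open>Powers and idempotents in a monoid\<close>

context monoid
begin

lemma idem_pow:
  assumes "e \<in> carrier G" "e \<otimes> e = e"
  shows "e [^] Suc k = e"
  using assms by (induction k) auto

lemma pow_mult_shift:
  assumes "p \<in> carrier G" "q \<in> carrier G"
  shows "(p \<otimes> q) [^] (k::nat) \<otimes> p = p \<otimes> (q \<otimes> p) [^] k"
proof (induction k)
  case (Suc k)
  have "(p \<otimes> q) [^] Suc k \<otimes> p = ((p \<otimes> q) [^] k \<otimes> p) \<otimes> (q \<otimes> p)"
    using assms by (simp add: m_assoc)
  also have "\<dots> = p \<otimes> (q \<otimes> p) [^] Suc k"
    using assms by (simp add: Suc m_assoc)
  finally show ?case .
qed (use assms in simp)

lemma idem_pow_mult:
  assumes "s \<in> carrier G" "s [^] (k::nat) \<otimes> s [^] k = s [^] k" "0 < m"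
  shows "s [^] (k * m) = s [^] k"
proof -
  obtain l where l: "m = Suc l"
    using assms(3) gr0_implies_Suc by blast
  have "s [^] (k * m) = (s [^] k) [^] Suc l"
    using assms(1) l by (simp only: nat_pow_pow)
  also have "\<dots> = s [^] k"
    using assms(1,2) by (intro idem_pow) auto
  finally show ?thesis .
qed

text \<open>Two idempotent powers \<open>s [^] k\<close> and \<open>s [^] l\<close> with positive
  exponents both equal \<open>s [^] (k * l)\<close>.\<close>

lemma omega_pow_eq:
  assumes s: "s \<in> carrier G" and idem: "s [^] k \<otimes> s [^] k = s [^] k" and k: "(k::nat) > 0"
  shows "omega_pow G s = s [^] k"
  unfolding omega_pow_def
proof (rule the_equality)
  show "(\<exists>l::nat. l > 0 \<and> s [^] k = s [^] l) \<and> s [^] k \<otimes> s [^] k = s [^] k"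
    using idem k by blast
next
  fix e
  assume "(\<exists>l::nat. l > 0 \<and> e = s [^] l) \<and> e \<otimes> e = e"
  then obtain l :: nat where l: "l > 0" "e = s [^] l" and "s [^] l \<otimes> s [^] l = s [^] l"
    by blast
  then have "s [^] l = s [^] (l * k)"
    using idem_pow_mult[OF s _ k] by simp
  also have "\<dots> = s [^] k"
    using idem_pow_mult[OF s idem l(1)] by (simp add: mult.commute)
  finally show "e = s [^] k"
    by (simp add: l(2))
qed

end

section \<open>Idempotent powers in a finite monoid\<close>

context finite_monoid
begin

text \<open>By pigeonhole the powers of \<open>s\<close> are periodic from some exponent
  \<open>i\<close> on, with period \<open>p\<close>. Doubling a multiple of \<open>p\<close> that is
  at least \<open>i\<close> does not change the power.\<close>

lemma ex_idem_pow:
  assumes s: "s \<in> carrier M"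
  shows "\<exists>k::nat. k > 0 \<and> s [^] k \<otimes> s [^] k = s [^] k"
proof -
  have "finite (range (\<lambda>i::nat. s [^] i))"
    using s by (intro finite_subset[OF _ finite_carrier]) auto
  then have "\<not> inj (\<lambda>i::nat. s [^] i)"
    using finite_imageD infinite_UNIV_nat by blast
  then obtain i j :: nat where ij: "i < j" "s [^] i = s [^] j"
    unfolding inj_on_def by (metis linorder_neqE_nat)
  define p where "p = j - i"
  have p: "p > 0" "s [^] (i + p) = s [^] i"
    using ij by (auto simp: p_def)
  have step: "s [^] (l + p) = s [^] l" if "i \<le> l" for l
  proof -
    have "s [^] (l + p) = s [^] (i + p) \<otimes> s [^] (l - i)"
      using that s by (simp add: nat_pow_mult add.commute)
    also have "\<dots> = s [^] l"
      using that s by (simp add: p(2) nat_pow_mult add.commute)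
    finally show ?thesis .
  qed
  have periodic: "s [^] (l + m * p) = s [^] l" if "i \<le> l" for l m
  proof (induction m)
    case (Suc m)
    then show ?case
      using step[of "l + m * p"] that by (simp add: ac_simps)
  qed simp
  \<comment> \<open>The factor \<open>Suc i\<close> instead of \<open>i\<close> keeps the exponent
    positive when \<open>i = 0\<close>.\<close>
  have "i \<le> i * p"
    using p(1) by simp
  then have "i \<le> Suc i * p"
    by (simp add: trans_le_add2)
  then have "s [^] (Suc i * p) \<otimes> s [^] (Suc i * p) = s [^] (Suc i * p)"
    using periodic[of "Suc i * p" "Suc i"] s by (simp only: nat_pow_mult)
  then show ?thesis
    using p(1) by (intro exI[of _ "Suc i * p"]) simp
qed

text \<open>The product of the individual exponents works for all elements. A common exponent turns
  \<omega> into an ordinary power, to which monotonicity of powers applies.\<close>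

lemma ex_uniform_idem_pow:
  obtains K :: nat where "K > 0" "\<And>s. s \<in> carrier M \<Longrightarrow> s [^] K \<otimes> s [^] K = s [^] K"
proof -
  obtain k :: "'a \<Rightarrow> nat" where
    k: "\<And>s. s \<in> carrier M \<Longrightarrow> k s > 0 \<and> s [^] k s \<otimes> s [^] k s = s [^] k s"
    using ex_idem_pow by metis
  define K where "K = prod k (carrier M)"
  have pos: "K > 0"
    unfolding K_def using k by (intro prod_pos) auto
  have "s [^] K \<otimes> s [^] K = s [^] K" if s: "s \<in> carrier M" for s
  proof -
    have "k s dvd K"
      unfolding K_def using s finite_carrier by (rule dvd_prodI[rotated])
    then obtain m where m: "K = k s * m" ..
    then have "s [^] K = s [^] k s"
      using idem_pow_mult k[OF s] s pos by simp
    then show ?thesis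
      using k[OF s] by simp
  qed
  then show ?thesis
    using that pos by blast
qed

end

section \<open>Elements above the identity in an ordered monoid\<close>

context finite_ordered_monoid
begin

abbreviation le (infix "\<preceq>" 50) where "a \<preceq> b \<equiv> (a, b) \<in> r"

lemma le_refl: "a \<in> carrier M \<Longrightarrow> a \<preceq> a"
  using partial_order unfolding partial_order_on_def preorder_on_def by (meson refl_onD)

lemma le_trans [trans]: "a \<preceq> b \<Longrightarrow> b \<preceq> c \<Longrightarrow> a \<preceq> c"
  using partial_order unfolding partial_order_on_def preorder_on_def by (meson transD)

lemma le_antisym: "a \<preceq> b \<Longrightarrow> b \<preceq> a \<Longrightarrow> a = b"
  using partial_order unfolding partial_order_on_def by (meson antisymD)

lemma le_carrier: "a \<preceq> b \<Longrightarrow> a \<in> carrier M \<and> b \<in> carrier M"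
  using partial_order unfolding partial_order_on_def preorder_on_def by blast

lemma mult_mono:
  assumes "a \<preceq> b" "c \<preceq> d"
  shows "a \<otimes> c \<preceq> b \<otimes> d"
  using le_trans[OF mult_right_mono[OF assms(1)] mult_left_mono[OF assms(2)]]
    le_carrier[OF assms(1)] le_carrier[OF assms(2)] by simp

lemma pow_mono: "a \<preceq> b \<Longrightarrow> a [^] (k::nat) \<preceq> b [^] k"
  by (induction k) (auto intro: le_refl mult_mono)

lemma le_mult_right: "\<one> \<preceq> b \<Longrightarrow> a \<in> carrier M \<Longrightarrow> a \<preceq> a \<otimes> b"
  using mult_left_mono[of \<one> b a] by simp

lemma le_mult_left: "\<one> \<preceq> b \<Longrightarrow> a \<in> carrier M \<Longrightarrow> a \<preceq> b \<otimes> a"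
  using mult_right_mono[of \<one> b a] by simp

lemma one_le_pow_nat: "\<one> \<preceq> u \<Longrightarrow> \<one> \<preceq> u [^] (k::nat)"
  using pow_mono[of \<one> u k] by simp

lemma le_pow:
  assumes "\<one> \<preceq> u" "0 < (k::nat)"
  shows "u \<preceq> u [^] k"
proof -
  obtain l where l: "k = Suc l"
    using assms(2) gr0_implies_Suc by blast
  show ?thesis
    using le_mult_left[OF one_le_pow_nat[OF assms(1)]] le_carrier[OF assms(1)] l by simp
qed

text \<open>The order excludes a nontrivial cycle of powers: from \<open>u \<preceq> u [^] k\<close>
  follows that \<open>u \<otimes> u [^] k\<close> is below the idempotent \<open>u [^] k\<close>,
  and \<open>\<one> \<preceq> u\<close> gives the converse.\<close>

lemma idem_pow_absorbs:
  assumes u: "\<one> \<preceq> u" and idem: "u [^] k \<otimes> u [^] k = u [^] k" and k: "0 < (k::nat)"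
  shows "u \<otimes> u [^] k = u [^] k"
proof (rule le_antisym)
  have uk: "u [^] k \<in> carrier M"
    using le_carrier[OF u] by simp
  show "u \<otimes> u [^] k \<preceq> u [^] k"
    using mult_right_mono[OF le_pow[OF u k] uk] by (simp add: idem)
  show "u [^] k \<preceq> u \<otimes> u [^] k"
    using le_mult_left[OF u uk] .
qed

text \<open>A \<open>u\<close> is inserted after every factor \<open>c\<close> but the last, which
  already has one.\<close>

lemma mult_pow_le_pow_mult:
  assumes u: "\<one> \<preceq> u" and c: "c \<in> carrier M" and m: "0 < (m::nat)"
  shows "c [^] m \<otimes> u \<preceq> (c \<otimes> u) [^] m"
proof -
  obtain l where l: "m = Suc l"
    using m gr0_implies_Suc by blast
  have "c [^] l \<otimes> (c \<otimes> u) \<preceq> (c \<otimes> u) [^] l \<otimes> (c \<otimes> u)"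
    using c u le_carrier[OF u] by (intro mult_right_mono pow_mono le_mult_right) auto
  then show ?thesis
    using c le_carrier[OF u] by (simp add: l m_assoc)
qed

end

section \<open>The two identities, with a fixed exponent in place of \<omega>\<close>

context one_le_pow_monoid
begin

lemma one_le_idem:
  assumes "n \<ge> 1" "e \<in> carrier M" "e \<otimes> e = e"
  shows "\<one> \<preceq> e"
proof -
  obtain l where "n = Suc l"
    using assms(1) by (cases n) auto
  then show ?thesis
    using one_le_pow[OF assms(2)] idem_pow[OF assms(2,3), of l] by simp
qed

lemma idem_mult_pow_commute:
  assumes n: "n \<ge> 1" and e: "e \<in> carrier M" "e \<otimes> e = e" and y: "y \<in> carrier M"
    and k: "0 < (k::nat)"
    and f: "(e \<otimes> y) [^] k \<otimes> (e \<otimes> y) [^] k = (e \<otimes> y) [^] k"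
    and g: "(y \<otimes> e) [^] k \<otimes> (y \<otimes> e) [^] k = (y \<otimes> e) [^] k"
  shows "(e \<otimes> y) [^] k = (y \<otimes> e) [^] k"
proof -
  define f' where "f' = (e \<otimes> y) [^] k"
  define g' where "g' = (y \<otimes> e) [^] k"
  have carr: "f' \<in> carrier M" "g' \<in> carrier M"
    using e y by (auto simp: f'_def g'_def)
  have idem: "f' \<otimes> f' = f'" "g' \<otimes> g' = g'"
    using f g by (auto simp: f'_def g'_def)
  have one_le: "\<one> \<preceq> e" "\<one> \<preceq> f'" "\<one> \<preceq> g'"
    using one_le_idem n e carr idem by auto
  have shift: "f' \<otimes> e = e \<otimes> g'"
    using pow_mult_shift e y by (simp add: f'_def g'_def)
  \<comment> \<open>A positive exponent exposes the last factor of \<open>g'\<close>, which ends in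
    \<open>e\<close>, and the first factor of \<open>f'\<close>, which begins with
    \<open>e\<close>.\<close>
  obtain l where l: "k = Suc l"
    using k gr0_implies_Suc by blast
  have ge: "g' \<otimes> e = g'"
    using e y by (simp add: g'_def l m_assoc)
  have "e \<otimes> (e \<otimes> y) = e \<otimes> y"
    using e y by (simp add: m_assoc[symmetric])
  then have ef: "e \<otimes> f' = f'"
    using e y nat_pow_Suc2[of "e \<otimes> y" l] by (simp add: f'_def l m_assoc[symmetric] del: nat_pow_Suc)
  have "f' \<otimes> e \<preceq> (f' \<otimes> e) \<otimes> f'"
    using le_mult_right one_le carr e by simp
  also have "(f' \<otimes> e) \<otimes> f' = f'"
    using carr e by (simp add: m_assoc ef idem)
  finally have "f' = f' \<otimes> e"
    using le_mult_right[OF one_le(1) carr(1)] le_antisym by blast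
  moreover have "e \<otimes> g' = g'"
  proof (rule le_antisym)
    have "e \<otimes> g' \<preceq> g' \<otimes> (e \<otimes> g')"
      using le_mult_left one_le carr e by simp
    also have "g' \<otimes> (e \<otimes> g') = g'"
      using carr e by (simp add: m_assoc[symmetric] ge idem)
    finally show "e \<otimes> g' \<preceq> g'" .
    show "g' \<preceq> e \<otimes> g'"
      using le_mult_left[OF one_le(1) carr(2)] .
  qed
  ultimately show ?thesis
    using shift by (simp add: f'_def g'_def)
qed

lemma sandwich_pow_eq:
  assumes n: "n \<ge> 1" and x: "x \<in> carrier M" and y: "y \<in> carrier M" and z: "z \<in> carrier M"
    and k: "0 < (k::nat)" and idem: "\<And>s. s \<in> carrier M \<Longrightarrow> s [^] k \<otimes> s [^] k = s [^] k"
  shows "(x \<otimes> y [^] k \<otimes> z) [^] Suc k = (x \<otimes> y [^] n \<otimes> z) [^] Suc k"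
proof (rule le_antisym)
  define u where "u = y [^] n"
  define a where "a = x \<otimes> u \<otimes> z"
  have carr: "u \<in> carrier M" "a \<in> carrier M"
    using x y z by (auto simp: u_def a_def)
  have u: "\<one> \<preceq> u"
    using one_le_pow y by (simp add: u_def)
  \<comment> \<open>Both sides equal \<open>y [^] (k * n)\<close>, so \<open>y\<close> enters only
    through \<open>u\<close> from here on.\<close>
  have yk: "y [^] k = u [^] k"
    using idem_pow_mult[OF y idem[OF y], of n] n y by (simp add: u_def nat_pow_pow mult.commute)
  have uk: "u \<otimes> u [^] k = u [^] k"
    using idem_pow_absorbs u idem carr k by simp
  have "x \<otimes> u \<otimes> z \<preceq> x \<otimes> u [^] k \<otimes> z"
    using le_pow[OF u k] x z by (intro mult_left_mono mult_right_mono)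
  then show "(x \<otimes> y [^] n \<otimes> z) [^] Suc k \<preceq> (x \<otimes> y [^] k \<otimes> z) [^] Suc k"
    unfolding yk u_def by (rule pow_mono)
  have "u \<preceq> (z \<otimes> x) [^] n \<otimes> u"
    using le_mult_left one_le_pow x z carr by simp
  also have "(z \<otimes> x) [^] n \<otimes> u \<preceq> (z \<otimes> x \<otimes> u) [^] n"
    using mult_pow_le_pow_mult[OF u] n x z by simp
  finally have "u [^] k \<preceq> (z \<otimes> x \<otimes> u) [^] (n * k)"
    using pow_mono[of u "(z \<otimes> x \<otimes> u) [^] n" k] x z carr by (simp add: nat_pow_pow)
  \<comment> \<open>Only \<open>u [^] k\<close> is enlarged. The spare \<open>u\<close> supplied by
    \<open>uk\<close> completes the leading \<open>x \<otimes> u\<close>, so that the whole product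
    regroups into a power of \<open>a\<close>.\<close>
  then have "x \<otimes> (u \<otimes> u [^] k) \<otimes> z \<preceq> x \<otimes> (u \<otimes> (z \<otimes> x \<otimes> u) [^] (n * k)) \<otimes> z"
    using x z carr by (intro mult_left_mono mult_right_mono)
  also have "x \<otimes> (u \<otimes> (z \<otimes> x \<otimes> u) [^] (n * k)) \<otimes> z = ((x \<otimes> u) \<otimes> (z \<otimes> (x \<otimes> u)) [^] (n * k)) \<otimes> z"
    using x z carr by (simp add: m_assoc)
  also have "\<dots> = a [^] Suc (n * k)"
    using x z carr pow_mult_shift[of "x \<otimes> u" z "n * k", symmetric] by (simp add: a_def m_assoc)
  finally have "(x \<otimes> y [^] k \<otimes> z) [^] Suc k \<preceq> (a [^] Suc (n * k)) [^] Suc k"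
    unfolding uk yk by (rule pow_mono)
  \<comment> \<open>The product of exponents is one more than a positive multiple of
    \<open>k\<close>, and idempotence of \<open>a [^] k\<close> reduces that multiple to
    \<open>k\<close>.\<close>
  also have "(a [^] Suc (n * k)) [^] Suc k = a [^] Suc (k * Suc (n * Suc k))"
    using carr(2) by (simp only: nat_pow_pow) (simp add: algebra_simps del: nat_pow_Suc)
  also have "a [^] Suc (k * Suc (n * Suc k)) = a [^] Suc k"
    using idem_pow_mult[OF carr(2) idem[OF carr(2)], of "Suc (n * Suc k)"]
    by (simp del: mult_Suc mult_Suc_right)
  finally show "(x \<otimes> y [^] k \<otimes> z) [^] Suc k \<preceq> (x \<otimes> y [^] n \<otimes> z) [^] Suc k"
    by (simp add: a_def u_def)
qed

end

theorem proposition4p2: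
  fixes M :: "('a, 'b) monoid_scheme" and r :: "'a rel" and n :: nat
  assumes "n \<ge> 1"
    and "one_le_pow_monoid M r n"
  shows "BG_n_monoid M n"
proof -
  interpret one_le_pow_monoid M r n
    by fact
  obtain k :: nat where k: "k > 0"
    and idem: "\<And>s. s \<in> carrier M \<Longrightarrow> s [^]\<^bsub>M\<^esub> k \<otimes>\<^bsub>M\<^esub> s [^]\<^bsub>M\<^esub> k = s [^]\<^bsub>M\<^esub> k"
    using ex_uniform_idem_pow by blast
  have omega: "omega_pow M s = s [^]\<^bsub>M\<^esub> k" if "s \<in> carrier M" for s
    using omega_pow_eq that idem k by blast
  show ?thesis
  proof unfold_locales
    fix x y assume "x \<in> carrier M" "y \<in> carrier M"
    then show "omega_pow M (omega_pow M x \<otimes>\<^bsub>M\<^esub> y) = omega_pow M (y \<otimes>\<^bsub>M\<^esub> omega_pow M x)"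
      using idem_mult_pow_commute[OF assms(1) _ _ _ k] idem by (simp add: omega)
  next
    fix x y z assume "x \<in> carrier M" "y \<in> carrier M" "z \<in> carrier M"
    then show "omega_succ_pow M (x \<otimes>\<^bsub>M\<^esub> omega_pow M y \<otimes>\<^bsub>M\<^esub> z) =
        omega_succ_pow M (x \<otimes>\<^bsub>M\<^esub> y [^]\<^bsub>M\<^esub> n \<otimes>\<^bsub>M\<^esub> z)"
      using sandwich_pow_eq[OF assms(1) _ _ _ k idem]
      by (simp add: omega omega_succ_pow_def)
  qed
qed

end
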